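(* Let $(\psi_i)_{i\ge 1}$ be i.i.d. random vectors in $\mathbb{R}^{d}$, $d\ge 1$, with $E[|\psi_1|_2^{\alpha}]<\infty$ for some $\alpha>d+1$. Let $q:\mathbb{R}^d\to(0,1]$ be a propensity taking finitely many rational values, $q(\psi)\in\{a_l/k_l: l=1,\dots,L\}$. For each $n$, let $\mathcal{G}_n$ be the partition of $\{1,\dots,n\}$ produced by the multi-level matching algorithm described in the context, applied to the units $\{1,\dots,n\}$ with covariates $(\psi_i)_{i=1}^n$ and propensity $q$, with grid sizes $m_l\asymp (n_l/k_l)^{1/(d+1)}$ and any numbers of balanced $k$-means iterations $T_l\ge 0$, for $l=1,\dots,L$. Then, as $n\to\infty$, with $\bar\psi_g=|g|^{-1}\sum_{i\in g}\psi_i$, $$\frac1n\sum_{g\in\mathcal{G}_n}\sum_{i\in g}|\psi_i-\bar\psi_g|_2^2=o_p\!\left(n^{2/\alpha-2/(d+1)}\right)=o_p(1).$$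
   Context: Notation: $|\cdot|_2$ is the Euclidean norm; $\psi^{(j)}$ is the $j$-th coordinate of $\psi$; $a\wedge b=\min(a,b)$. Single-level algorithm. Input: a set of units $S\subseteq\{1,\dots,n\}$, covariates $\psi_i\in\mathbb{R}^d$, group size $k$, grid size (integer) $m\ge1$, iteration count $T\ge0$. (1) Preprocessing. Choose a remainder set $r\subseteq S$ with $|r|<k$ (any choice) such that $S'=S\setminus r$ has cardinality divisible by $k$. For $i\in S'$ set $\phi_i^{(j)}=(\psi_i^{(j)}-\min_{i'\in S'}\psi_{i'}^{(j)})/(\max_{i'\in S'}\psi_{i'}^{(j)}-\min_{i'\in S'}\psi_{i'}^{(j)})$, so $\phi_i\in[0,1]^d$. (A coordinate with zero range over $S'$ is excluded from the sorting step; equivalently set $\phi_i^{(j)}=0$.) (2) Spatial sorting. Define $\rho_1(z_1)=z_1$ and, for $v\ge2$ and $z\in\{0,\dots,m-1\}^v$, $\rho_v(z_1,\dots,z_v)=z_v m^{v-1}+\rho_{v-1}(z_1,\dots,z_{v-1})$ if $z_v$ is even, and $\rho_v(z_1,\dots,z_v)=z_v m^{v-1}+m^{v-1}-1-\rho_{v-1}(z_1,\dots,z_{v-1})$ if $z_v$ is odd. For $x\in[0,1]^d$ let $\rho(x)=\rho_d(\lfloor m x\rfloor\wedge(m-1))$ (floor and min componentwise). Sort the units in $S'$ by $\rho(\phi_i)$, breaking ties at random, and match consecutive units into groups of size $k$. This gives a partition $\mathcal{G}^{(0)}$ of $S'$. (3) Balanced $k$-means polishing. Given the partition $\mathcal{G}^{(t)}=\{g_1,\dots,g_K\}$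 of $S'$ into groups of size $k$ with centroids $\bar\psi_{g_s}^{(t)}$, let $\mathcal{G}^{(t+1)}=\{g_1',\dots,g_K'\}$ minimize $\sum_{s=1}^K\sum_{i\in g_s'}|\psi_i-\bar\psi_{g_s}^{(t)}|_2^2$ over all labelled partitions of $S'$ into $K$ groups of size $k$. Run for $t=0,\dots,T-1$. Output: $\mathcal{G}^{(T)}\cup\{r\}$ (omitting $r$ if empty). Multi-level algorithm. Let $S_l=\{i: q(\psi_i)=a_l/k_l\}$, $l=1,\dots,L$. Run the single-level algorithm on each $S_l$ with group size $k_l$, grid size $m_l$, iteration count $T_l$ and remainder $r_l$; let $n_l=|S_l\setminus r_l|$. The output is the union over $l$ of the resulting partitions. $m_l\asymp (n_l/k_l)^{1/(d+1)}$ means that the ratio of the two sides is bounded above and below by positive constants (uniformly in $n$ and $l$, whenever $n_l\ge 1$). *)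

theory Defs
  imports "HOL-Probability.Probability"
begin

text \<open>Covariates are vectors in \<open>real ^ 'd\<close>. The finite index type \<open>'d\<close> carries no order, while
  the sorting step depends on the order of the coordinates; an enumeration
  \<open>e\<close> with \<open>bij_betw e {1..CARD('d)} UNIV\<close> supplies it, \<open>x $ e j\<close> being the \<open>j\<close>-th coordinate
  of \<open>x\<close>. The steps of the algorithm that involve an arbitrary or random choice (remainder, order
  among ties, minimizer) are relations between input and admissible output.\<close>

subsection \<open>Preprocessing and spatial sorting\<close>

text \<open>A coordinate of zero range over \<open>S\<close> becomes \<open>0 / 0 = 0\<close>, which is the intended
  convention for such coordinates.\<close>

definition rescale :: "(nat \<Rightarrow> real ^ 'd) \<Rightarrow> nat set \<Rightarrow> nat \<Rightarrow> real ^ 'd" where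
  "rescale \<psi> S i = (\<chi> j. (\<psi> i $ j - Min ((\<lambda>i'. \<psi> i' $ j) ` S)) /
      (Max ((\<lambda>i'. \<psi> i' $ j) ` S) - Min ((\<lambda>i'. \<psi> i' $ j) ` S)))"

text \<open>\<open>snake m v z\<close> is $\rho_v(z_1, \ldots, z_v)$ on the grid $\{0, \ldots, m-1\}^v$; the clause
  for \<open>v = 0\<close> only makes the function total.\<close>

fun snake :: "nat \<Rightarrow> nat \<Rightarrow> (nat \<Rightarrow> int) \<Rightarrow> int" where
  "snake m 0 z = 0"
| "snake m (Suc 0) z = z 1"
| "snake m (Suc (Suc v)) z =
    (if even (z (Suc (Suc v)))
     then z (Suc (Suc v)) * int m ^ Suc v + snake m (Suc v) z
     else z (Suc (Suc v)) * int m ^ Suc v + int m ^ Suc v - 1 - snake m (Suc v) z)"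

definition cell_rank :: "(nat \<Rightarrow> 'd::finite) \<Rightarrow> nat \<Rightarrow> real ^ 'd \<Rightarrow> int" where
  "cell_rank e m x = snake m CARD('d) (\<lambda>j. min \<lfloor>real m * (x $ e j)\<rfloor> (int m - 1))"

definition spatially_sorted ::
    "(nat \<Rightarrow> 'd::finite) \<Rightarrow> (nat \<Rightarrow> real ^ 'd) \<Rightarrow> nat \<Rightarrow> nat set \<Rightarrow> nat list \<Rightarrow> bool" where
  "spatially_sorted e \<psi> m S xs \<longleftrightarrow>
     distinct xs \<and> set xs = S \<and> sorted (map (\<lambda>i. cell_rank e m (rescale \<psi> S i)) xs)"

text \<open>Groups are labelled \<open>0, \<dots>, K - 1\<close>.\<close>

definition block :: "nat \<Rightarrow> nat list \<Rightarrow> nat \<Rightarrow> nat set" where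
  "block k xs s = set (take k (drop (s * k) xs))"

subsection \<open>Balanced k-means polishing\<close>

definition centroid :: "(nat \<Rightarrow> real ^ 'd) \<Rightarrow> nat set \<Rightarrow> real ^ 'd" where
  "centroid \<psi> g = (1 / real (card g)) *\<^sub>R (\<Sum>i\<in>g. \<psi> i)"

definition labelled_partition :: "nat set \<Rightarrow> nat \<Rightarrow> nat \<Rightarrow> (nat \<Rightarrow> nat set) \<Rightarrow> bool" where
  "labelled_partition S k K g \<longleftrightarrow>
     (\<forall>s<K. card (g s) = k) \<and> disjoint_family_on g {..<K} \<and> (\<Union>s<K. g s) = S"

definition kmeans_step ::
    "(nat \<Rightarrow> real ^ 'd) \<Rightarrow> nat set \<Rightarrow> nat \<Rightarrow> (nat \<Rightarrow> nat set) \<Rightarrow> (nat \<Rightarrow> nat set) \<Rightarrow> bool" where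
  "kmeans_step \<psi> S k g g' \<longleftrightarrow>
     is_arg_min (\<lambda>h. \<Sum>s<card S div k. \<Sum>i\<in>h s. (norm (\<psi> i - centroid \<psi> (g s)))\<^sup>2)
       (labelled_partition S k (card S div k)) g'"

subsection \<open>The matching algorithms\<close>

definition single_level ::
    "(nat \<Rightarrow> 'd::finite) \<Rightarrow> (nat \<Rightarrow> real ^ 'd) \<Rightarrow> nat set \<Rightarrow> nat \<Rightarrow> nat \<Rightarrow> nat \<Rightarrow> nat set \<Rightarrow> nat set set \<Rightarrow> bool"
  where
  "single_level e \<psi> S k m T r P \<longleftrightarrow>
     r \<subseteq> S \<and> card r < k \<and> k dvd card (S - r) \<and>
     (\<exists>xs g. spatially_sorted e \<psi> m (S - r) xs \<and>
        (kmeans_step \<psi> (S - r) k ^^ T) (block k xs) g \<and>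
        P = g ` {..<card (S - r) div k} \<union> (if r = {} then {} else {r}))"

text \<open>The units of level \<open>l\<close> among \<open>1, \<dots>, n\<close>, where \<open>a l / k l\<close> is the \<open>l\<close>-th propensity value.\<close>

definition level_units ::
    "(real ^ 'd \<Rightarrow> real) \<Rightarrow> (nat \<Rightarrow> nat) \<Rightarrow> (nat \<Rightarrow> nat) \<Rightarrow> (nat \<Rightarrow> real ^ 'd) \<Rightarrow> nat \<Rightarrow> nat \<Rightarrow> nat set" where
  "level_units q a k \<psi> n l = {i \<in> {1..n}. q (\<psi> i) = real (a l) / real (k l)}"

definition multi_level ::
    "(nat \<Rightarrow> 'd::finite) \<Rightarrow> (real ^ 'd \<Rightarrow> real) \<Rightarrow> nat \<Rightarrow> (nat \<Rightarrow> nat) \<Rightarrow> (nat \<Rightarrow> nat) \<Rightarrow> (nat \<Rightarrow> real ^ 'd) \<Rightarrow> nat \<Rightarrow>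
     (nat \<Rightarrow> nat) \<Rightarrow> (nat \<Rightarrow> nat) \<Rightarrow> (nat \<Rightarrow> nat set) \<Rightarrow> nat set set \<Rightarrow> bool" where
  "multi_level e q L a k \<psi> n m T r G \<longleftrightarrow>
     (\<exists>P. (\<forall>l\<in>{1..L}. single_level e \<psi> (level_units q a k \<psi> n l) (k l) (m l) (T l) (r l) (P l)) \<and>
          G = (\<Union>l\<in>{1..L}. P l))"

subsection \<open>Within-group variation and stochastic order\<close>

definition within_group_loss :: "(nat \<Rightarrow> real ^ 'd) \<Rightarrow> nat \<Rightarrow> nat set set \<Rightarrow> real" where
  "within_group_loss \<psi> n G =
     (1 / real n) * (\<Sum>g\<in>G. \<Sum>i\<in>g. (norm (\<psi> i - centroid \<psi> g))\<^sup>2)"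

text \<open>$X_n = o_p(b_n)$: $X_n / b_n$ converges to zero in probability. Measurability of the
  $X_n$ is included since \<open>measure\<close> is \<open>0\<close> on non-measurable sets.\<close>

definition small_o_prob :: "'w measure \<Rightarrow> (nat \<Rightarrow> 'w \<Rightarrow> real) \<Rightarrow> (nat \<Rightarrow> real) \<Rightarrow> bool" where
  "small_o_prob M X b \<longleftrightarrow>
     (\<forall>n. X n \<in> borel_measurable M) \<and>
     (\<forall>\<epsilon>>0. (\<lambda>n. measure M {\<omega> \<in> space M. \<bar>X n \<omega> / b n\<bar> > \<epsilon>}) \<longlonglongrightarrow> 0)"

end

theory Submission
  imports Defs
begin

text \<open>If all covariates have norm at most \<open>R\<close>, the loss is at most a constant times
  $R^2 n^{-2/(d+1)}$. The snake order moves between adjacent cells, so the $\ell^1$-distance of two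
  cells is at most the difference of their ranks. Hence in a group whose ranks span $\Delta$ the squared
  rescaled distances are at most $d/m^2 + 2\Delta/m$, and since the spans of consecutive groups add up
  to at most $m^d$, one level contributes $O(R^2 (n_l/m_l^2 + m_l^{d-1}))$, which the choice of $m_l$
  balances. Polishing never increases the loss, and a remainder contributes $O(R^2)$. By the union bound
  and $t P(Y > t) \to 0$ for integrable $Y = |\psi_1|^\alpha$, the event
  $\max_{i \le n} |\psi_i| > \delta n^{1/\alpha}$ has vanishing probability for every $\delta > 0$.\<close>

subsection \<open>The snake order\<close>

text \<open>Call the cells with a fixed last coordinate \<open>x\<close> a layer, and let
  \<open>A\<close> be the number of its cells. The ranks in it lie between \<open>x * A\<close> and
  \<open>x * A + A - 1\<close>, since an odd layer only reflects the inner rank.\<close>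

lemma snake_bounds:
  assumes "\<And>j. j \<in> {1..v} \<Longrightarrow> 0 \<le> z j \<and> z j \<le> int m - 1"
  shows "0 \<le> snake m v z \<and> snake m v z \<le> int m ^ v - 1"
  using assms
proof (induction v rule: induct_nat_012)
  case (ge2 v)
  define A where "A = int m ^ Suc v"
  let ?s = "snake m (Suc v) z" and ?z = "z (Suc (Suc v))"
  have s: "0 \<le> ?s \<and> ?s \<le> A - 1"
    unfolding A_def by (intro ge2.IH(2) ge2.prems) auto
  have z: "0 \<le> ?z" "?z \<le> int m - 1" using ge2.prems[of "Suc (Suc v)"] by auto
  have "?z * A \<le> (int m - 1) * A" "0 \<le> ?z * A"
    using z by (auto intro!: mult_right_mono simp: A_def)
  moreover have "(int m - 1) * A = int m ^ Suc (Suc v) - A" by (simp add: A_def algebra_simps)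
  ultimately show ?case using s unfolding snake.simps by (auto simp flip: A_def simp del: power_Suc)
qed auto

text \<open>Here \<open>x\<close> and \<open>x'\<close> are the last coordinates and
  \<open>s\<close>, \<open>s'\<close> the inner ranks of two cells. In adjacent layers the parities
  differ and the snake turns around, so the ranks differ by \<open>1 + s + s'\<close> or
  \<open>2 * A - 1 - s - s'\<close>; both are at least \<open>1 + \<bar>s' - s\<bar>\<close>.
  Otherwise a full layer lies in between.\<close>

lemma snake_step:
  fixes A s s' x x' :: int
  assumes "0 \<le> s" "s \<le> A - 1" "0 \<le> s'" "s' \<le> A - 1" "x < x'"
  shows "x' - x + \<bar>s' - s\<bar> \<le>
    (if even x' then x' * A + s' else x' * A + A - 1 - s') - (if even x then x * A + s else x * A + A - 1 - s)"
proof (cases "x' = x + 1")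
  case True
  then show ?thesis using assms by (auto simp: algebra_simps)
next
  case False
  \<comment> \<open>Expanding the product compares the extreme cases:
    \<open>\<bar>s' - s\<bar>\<close> is at most \<open>A - 1\<close>, and the ranks differ by at
    least \<open>x' * A - x * A - A + 1\<close>.\<close>
  then have "0 \<le> (x' - x - 2) * (A - 1)" using assms by (intro mult_nonneg_nonneg) auto
  then have "x' - x + (A - 1) \<le> x' * A - x * A - A + 1" by (simp add: algebra_simps)
  then show ?thesis using assms by (auto simp: algebra_simps)
qed

text \<open>Induction on the dimension. If the last coordinates agree, the inner ranks are both kept
  or both reflected, which preserves their distance; otherwise \<open>snake_step\<close> applies, in
  one order or the other.\<close>

lemma snake_dist:
  assumes "\<And>j. j \<in> {1..v} \<Longrightarrow> 0 \<le> z j \<and> z j \<le> int m - 1"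
    and "\<And>j. j \<in> {1..v} \<Longrightarrow> 0 \<le> z' j \<and> z' j \<le> int m - 1"
  shows "(\<Sum>j=1..v. \<bar>z' j - z j\<bar>) \<le> \<bar>snake m v z' - snake m v z\<bar>"
  using assms
proof (induction v rule: induct_nat_012)
  case (ge2 v)
  define A where "A = int m ^ Suc v"
  let ?s = "snake m (Suc v) z" and ?z = "z (Suc (Suc v))"
  let ?s' = "snake m (Suc v) z'" and ?z' = "z' (Suc (Suc v))"
  have s: "0 \<le> ?s" "?s \<le> A - 1" "0 \<le> ?s'" "?s' \<le> A - 1"
    using snake_bounds[of "Suc v" z m] snake_bounds[of "Suc v" z' m] ge2.prems
    by (auto simp: A_def)
  have IH: "(\<Sum>j=1..Suc v. \<bar>z' j - z j\<bar>) \<le> \<bar>?s' - ?s\<bar>"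
    by (intro ge2.IH(2) ge2.prems) auto
  consider "?z = ?z'" | "?z < ?z'" | "?z' < ?z" by linarith
  then have "\<bar>?z' - ?z\<bar> + \<bar>?s' - ?s\<bar> \<le> \<bar>snake m (Suc (Suc v)) z' - snake m (Suc (Suc v)) z\<bar>"
  proof cases
    case 1
    then show ?thesis by (simp add: abs_minus_commute)
  next
    case 2
    show ?thesis using snake_step[OF s 2] 2 unfolding snake.simps A_def by (auto split: if_splits)
  next
    case 3
    show ?thesis using snake_step[OF s(3,4,1,2) 3] 3 unfolding snake.simps A_def by (auto split: if_splits)
  qed
  with IH show ?case by simp
qed auto

section \<open>Grid cells and distances in the unit cube\<close>

definition cell :: "nat \<Rightarrow> real \<Rightarrow> int" where
  "cell m x = min \<lfloor>real m * x\<rfloor> (int m - 1)"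

lemma cell_bounds:
  assumes "0 \<le> x" "m \<ge> 1"
  shows "0 \<le> cell m x \<and> cell m x \<le> int m - 1"
  using assms by (auto simp: cell_def)

text \<open>The cap at \<open>m - 1\<close> takes effect only at \<open>x = 1\<close>, where
  \<open>m * x\<close> is the right end of the last cell; hence the upper bound is not
  strict.\<close>

lemma cell_sandwich:
  assumes "x \<le> 1" "m \<ge> 1"
  shows "of_int (cell m x) \<le> real m * x" "real m * x \<le> of_int (cell m x) + 1"
proof -
  have "real m * x \<le> real m" using assms by (simp add: mult_left_le)
  then show "of_int (cell m x) \<le> real m * x" "real m * x \<le> of_int (cell m x) + 1"
    unfolding cell_def by linarith+
qed

text \<open>The bound is linear, not quadratic, in the cell distance so that it can be summed along the
  snake; this uses that \<open>x\<close> and \<open>y\<close> are at distance at most 1.\<close>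

lemma cell_square_dist:
  assumes x: "0 \<le> x" "x \<le> 1" and y: "0 \<le> y" "y \<le> 1" and m: "m \<ge> 1"
  shows "(x - y)\<^sup>2 \<le> 1 / (real m)\<^sup>2 + 2 * of_int \<bar>cell m x - cell m y\<bar> / real m"
proof -
  define D where "D = real_of_int \<bar>cell m x - cell m y\<bar>"
  have "real m * \<bar>x - y\<bar> = \<bar>real m * x - real m * y\<bar>"
    by (simp add: abs_mult flip: right_diff_distrib)
  also have "\<dots> \<le> D + 1"
    using cell_sandwich[OF x(2) m] cell_sandwich[OF y(2) m] unfolding D_def by linarith
  finally have le: "real m * \<bar>x - y\<bar> \<le> D + 1" .
  \<comment> \<open>As an integer, \<open>D\<close> either vanishes, which leaves the width of a
    single cell, or is large enough for \<open>D + 1 \<le> 2 * D\<close>.\<close>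
  have "D = 0 \<or> D \<ge> 1" unfolding D_def by (auto simp: abs_if)
  then show ?thesis
  proof
    assume D: "D = 0"
    then have "\<bar>x - y\<bar> \<le> 1 / real m" using le m by (simp add: field_simps)
    then have "\<bar>x - y\<bar>\<^sup>2 \<le> (1 / real m)\<^sup>2" by (intro power_mono) auto
    then show ?thesis using D by (simp add: D_def power_divide)
  next
    assume D: "D \<ge> 1"
    then have *: "\<bar>x - y\<bar> \<le> 2 * D / real m" using le m by (simp add: field_simps)
    have "\<bar>x - y\<bar> * \<bar>x - y\<bar> \<le> 1 * (2 * D / real m)"
      using x y by (intro mult_mono *) auto
    then have "(x - y)\<^sup>2 \<le> 2 * D / real m" by (simp add: power2_eq_square)
    also have "\<dots> \<le> 1 / (real m)\<^sup>2 + 2 * D / real m" by simp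
    finally show ?thesis unfolding D_def .
  qed
qed

lemma cell_rank_cell: "cell_rank e m x = snake m CARD('d) (\<lambda>j. cell m (x $ e j))"
  for x :: "real ^ 'd::finite"
  by (simp add: cell_rank_def cell_def)

lemma cell_rank_bounds:
  fixes x :: "real ^ 'd::finite"
  assumes "\<And>j. 0 \<le> x $ j" "m \<ge> 1"
  shows "0 \<le> cell_rank e m x" "cell_rank e m x \<le> int m ^ CARD('d) - 1"
  using snake_bounds[of "CARD('d)" "\<lambda>j. cell m (x $ e j)" m] cell_bounds assms
  by (auto simp: cell_rank_cell)

text \<open>The linear bounds of \<open>cell_square_dist\<close> add up over the coordinates to the
  l1-distance of the two cells, which \<open>snake_dist\<close> controls by the ranks. The
  enumeration \<open>e\<close> reorders the sum.\<close>

lemma cell_rank_dist: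
  fixes x y :: "real ^ 'd::finite"
  assumes e: "bij_betw e {1..CARD('d)} UNIV" and m: "m \<ge> 1"
    and x: "\<And>j. 0 \<le> x $ j \<and> x $ j \<le> 1" and y: "\<And>j. 0 \<le> y $ j \<and> y $ j \<le> 1"
  shows "(\<Sum>j\<in>UNIV. (x $ j - y $ j)\<^sup>2) \<le>
    real CARD('d) / (real m)\<^sup>2 + 2 * of_int \<bar>cell_rank e m x - cell_rank e m y\<bar> / real m"
proof -
  have "(\<Sum>j\<in>UNIV. \<bar>cell m (x $ j) - cell m (y $ j)\<bar>) =
      (\<Sum>i=1..CARD('d). \<bar>cell m (x $ e i) - cell m (y $ e i)\<bar>)"
    using sum.reindex_bij_betw[OF e, of "\<lambda>j. \<bar>cell m (x $ j) - cell m (y $ j)\<bar>"] by simp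
  also have "\<dots> \<le> \<bar>cell_rank e m x - cell_rank e m y\<bar>"
    unfolding cell_rank_cell by (intro snake_dist cell_bounds) (use x y m in auto)
  finally have *: "(\<Sum>j\<in>UNIV. \<bar>cell m (x $ j) - cell m (y $ j)\<bar>) \<le> \<bar>cell_rank e m x - cell_rank e m y\<bar>" .
  have "(\<Sum>j\<in>UNIV. (x $ j - y $ j)\<^sup>2) \<le>
      (\<Sum>j\<in>UNIV. 1 / (real m)\<^sup>2 + 2 * of_int \<bar>cell m (x $ j) - cell m (y $ j)\<bar> / real m)"
    by (intro sum_mono cell_square_dist) (use x y m in auto)
  also have "\<dots> = real CARD('d) / (real m)\<^sup>2 +
      2 * of_int (\<Sum>j\<in>UNIV. \<bar>cell m (x $ j) - cell m (y $ j)\<bar>) / real m"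
    by (simp add: sum.distrib flip: sum_divide_distrib sum_distrib_left)
  also have "\<dots> \<le> real CARD('d) / (real m)\<^sup>2 + 2 * of_int \<bar>cell_rank e m x - cell_rank e m y\<bar> / real m"
    using * by (intro add_left_mono divide_right_mono mult_left_mono) (auto simp flip: of_int_abs simp del: of_int_sum)
  finally show ?thesis .
qed

subsection \<open>Distances of covariates\<close>

lemma rescale_bounds:
  assumes "finite S" "i \<in> S"
  shows "0 \<le> rescale \<psi> S i $ j" "rescale \<psi> S i $ j \<le> 1"
proof -
  let ?A = "(\<lambda>i'. \<psi> i' $ j) ` S"
  have "Min ?A \<le> \<psi> i $ j" "\<psi> i $ j \<le> Max ?A" using assms by auto
  then show "0 \<le> rescale \<psi> S i $ j" "rescale \<psi> S i $ j \<le> 1"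
    by (auto simp: rescale_def divide_le_eq_1)
qed

text \<open>Undoing the rescaling multiplies differences by the range of the coordinate over
  \<open>S\<close>, which is at most \<open>2 * R\<close>.\<close>

lemma coordinate_dist_le_rescale:
  fixes \<psi> :: "nat \<Rightarrow> real ^ 'd::finite"
  assumes S: "finite S" "i \<in> S" "i' \<in> S" and R: "\<And>i. i \<in> S \<Longrightarrow> norm (\<psi> i) \<le> R"
  shows "\<bar>\<psi> i $ j - \<psi> i' $ j\<bar> \<le> 2 * R * \<bar>rescale \<psi> S i $ j - rescale \<psi> S i' $ j\<bar>"
proof -
  let ?A = "(\<lambda>i'. \<psi> i' $ j) ` S"
  define lo hi where "lo = Min ?A" and "hi = Max ?A"
  have A: "finite ?A" "?A \<noteq> {}" using S by auto
  have coord: "\<bar>\<psi> i $ j\<bar> \<le> R" if "i \<in> S" for i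
    using component_le_norm_cart[of "\<psi> i" j] R[OF that] by linarith
  have "\<bar>lo\<bar> \<le> R" "\<bar>hi\<bar> \<le> R"
    using Min_in[OF A] Max_in[OF A] coord unfolding lo_def hi_def by auto
  then have range: "hi - lo \<le> 2 * R" by linarith
  have in_range: "lo \<le> \<psi> i $ j \<and> \<psi> i $ j \<le> hi" if "i \<in> S" for i
    using A that by (auto simp: lo_def hi_def)
  have "\<psi> i $ j - \<psi> i' $ j = (hi - lo) * (rescale \<psi> S i $ j - rescale \<psi> S i' $ j)"
  \<comment> \<open>With zero range the coordinate is constant on \<open>S\<close>, so both sides
    vanish whatever value the division by zero gives.\<close>
  proof (cases "hi = lo")
    case True
    then show ?thesis using in_range[OF S(2)] in_range[OF S(3)] by simp
  next
    case False
    have "rescale \<psi> S i $ j - rescale \<psi> S i' $ j = (\<psi> i $ j - \<psi> i' $ j) / (hi - lo)"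
      by (simp add: rescale_def lo_def hi_def flip: diff_divide_distrib)
    then show ?thesis using False by simp
  qed
  moreover have "0 \<le> hi - lo" using in_range[OF S(2)] by simp
  ultimately show ?thesis using range by (simp add: abs_mult mult_right_mono)
qed

text \<open>The factor \<open>4 * R\<^sup>2\<close> is the square of the bound \<open>2 * R\<close>
  on the coordinate ranges.\<close>

lemma norm_dist_le_cell_rank:
  fixes \<psi> :: "nat \<Rightarrow> real ^ 'd::finite"
  assumes e: "bij_betw e {1..CARD('d)} UNIV" and m: "m \<ge> 1"
    and S: "finite S" "i \<in> S" "i' \<in> S" and R: "\<And>i. i \<in> S \<Longrightarrow> norm (\<psi> i) \<le> R"
  shows "(norm (\<psi> i - \<psi> i'))\<^sup>2 \<le> 4 * R\<^sup>2 * (real CARD('d) / (real m)\<^sup>2 +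
    2 * of_int \<bar>cell_rank e m (rescale \<psi> S i) - cell_rank e m (rescale \<psi> S i')\<bar> / real m)"
proof -
  let ?\<phi> = "rescale \<psi> S"
  have "(norm (\<psi> i - \<psi> i'))\<^sup>2 = (\<Sum>j\<in>UNIV. (\<psi> i $ j - \<psi> i' $ j)\<^sup>2)"
    by (simp add: norm_vec_def L2_set_def sum_nonneg)
  also have "\<dots> \<le> (\<Sum>j\<in>UNIV. 4 * R\<^sup>2 * (?\<phi> i $ j - ?\<phi> i' $ j)\<^sup>2)"
  proof (rule sum_mono)
    fix j
    have "\<bar>\<psi> i $ j - \<psi> i' $ j\<bar>\<^sup>2 \<le> (2 * R * \<bar>?\<phi> i $ j - ?\<phi> i' $ j\<bar>)\<^sup>2"
      by (intro power_mono coordinate_dist_le_rescale S R) auto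
    then show "(\<psi> i $ j - \<psi> i' $ j)\<^sup>2 \<le> 4 * R\<^sup>2 * (?\<phi> i $ j - ?\<phi> i' $ j)\<^sup>2"
      by (simp add: power_mult_distrib)
  qed
  also have "\<dots> = 4 * R\<^sup>2 * (\<Sum>j\<in>UNIV. (?\<phi> i $ j - ?\<phi> i' $ j)\<^sup>2)"
    by (simp add: sum_distrib_left)
  also have "\<dots> \<le> 4 * R\<^sup>2 * (real CARD('d) / (real m)\<^sup>2 +
      2 * of_int \<bar>cell_rank e m (?\<phi> i) - cell_rank e m (?\<phi> i')\<bar> / real m)"
    by (intro mult_left_mono cell_rank_dist e m) (use rescale_bounds S in auto)
  finally show ?thesis .
qed

subsection \<open>Group losses under polishing\<close>

text \<open>Expand the squares around the centroid: the deviations from it sum to zero, so the cross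
  term drops out and only a nonnegative term in \<open>?c - p\<close> is added.\<close>

lemma centroid_minimizes:
  fixes \<psi> :: "nat \<Rightarrow> real ^ 'd::finite"
  assumes "finite g"
  shows "(\<Sum>i\<in>g. (norm (\<psi> i - centroid \<psi> g))\<^sup>2) \<le> (\<Sum>i\<in>g. (norm (\<psi> i - p))\<^sup>2)"
proof (cases "g = {}")
  case False
  let ?c = "centroid \<psi> g"
  have "real (card g) *\<^sub>R ?c = (\<Sum>i\<in>g. \<psi> i)" using False assms by (simp add: centroid_def)
  then have "(\<Sum>i\<in>g. \<psi> i - ?c) = 0" by (simp add: sum_subtractf sum_constant_scaleR del: sum_constant)
  then have zero: "(\<Sum>i\<in>g. (\<psi> i - ?c) \<bullet> (?c - p)) = 0" by (simp flip: inner_sum_left)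
  have "(norm (\<psi> i - p))\<^sup>2 =
      (norm (\<psi> i - ?c))\<^sup>2 + 2 * ((\<psi> i - ?c) \<bullet> (?c - p)) + (norm (?c - p))\<^sup>2" for i
    by (simp add: power2_norm_eq_inner algebra_simps inner_commute)
  then have "(\<Sum>i\<in>g. (norm (\<psi> i - p))\<^sup>2) =
      (\<Sum>i\<in>g. (norm (\<psi> i - ?c))\<^sup>2) + 2 * (\<Sum>i\<in>g. (\<psi> i - ?c) \<bullet> (?c - p)) + (\<Sum>i\<in>g. (norm (?c - p))\<^sup>2)"
    by (simp only: sum.distrib sum_distrib_left)
  then show ?thesis using zero by simp
qed simp

definition group_loss :: "(nat \<Rightarrow> real ^ 'd) \<Rightarrow> nat set \<Rightarrow> real" where
  "group_loss \<psi> g = (\<Sum>i\<in>g. (norm (\<psi> i - centroid \<psi> g))\<^sup>2)"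

lemma group_loss_nonneg: "0 \<le> group_loss \<psi> g"
  by (simp add: group_loss_def sum_nonneg)

text \<open>There are two improvements. With the old centroids held fixed, \<open>g'\<close> does at
  least as well as \<open>g\<close>, which is itself a feasible partition; replacing the old
  centroids by those of \<open>g'\<close> then lowers the loss by
  \<open>centroid_minimizes\<close>.\<close>

lemma kmeans_step_decreases:
  fixes \<psi> :: "nat \<Rightarrow> real ^ 'd::finite"
  assumes "kmeans_step \<psi> S k g g'" "labelled_partition S k (card S div k) g" "k \<ge> 1"
  shows "labelled_partition S k (card S div k) g'"
    and "(\<Sum>s<card S div k. group_loss \<psi> (g' s)) \<le> (\<Sum>s<card S div k. group_loss \<psi> (g s))"
proof -
  show g': "labelled_partition S k (card S div k) g'"
    using assms(1) by (auto simp: kmeans_step_def is_arg_min_def)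
  \<comment> \<open>Infinite sets have \<open>card\<close> equal to 0, so a group of size
    \<open>k \<ge> 1\<close> is finite.\<close>
  then have fin: "finite (g' s)" if "s < card S div k" for s
    using that assms(3) by (auto simp: labelled_partition_def intro!: card_ge_0_finite)
  have "(\<Sum>s<card S div k. group_loss \<psi> (g' s)) \<le>
      (\<Sum>s<card S div k. \<Sum>i\<in>g' s. (norm (\<psi> i - centroid \<psi> (g s)))\<^sup>2)"
    unfolding group_loss_def by (intro sum_mono centroid_minimizes fin) auto
  also have "\<dots> \<le> (\<Sum>s<card S div k. group_loss \<psi> (g s))"
    using assms(1,2) unfolding kmeans_step_def is_arg_min_linorder group_loss_def by blast
  finally show "(\<Sum>s<card S div k. group_loss \<psi> (g' s)) \<le> (\<Sum>s<card S div k. group_loss \<psi> (g s))" .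
qed

lemma kmeans_iterate_decreases:
  fixes \<psi> :: "nat \<Rightarrow> real ^ 'd::finite"
  assumes "(kmeans_step \<psi> S k ^^ T) g g'" "labelled_partition S k (card S div k) g" "k \<ge> 1"
  shows "labelled_partition S k (card S div k) g' \<and>
    (\<Sum>s<card S div k. group_loss \<psi> (g' s)) \<le> (\<Sum>s<card S div k. group_loss \<psi> (g s))"
  using assms(1)
proof (induction T arbitrary: g')
  case 0
  then show ?case using assms(2) by simp
next
  case (Suc T)
  then obtain h where h: "(kmeans_step \<psi> S k ^^ T) g h" "kmeans_step \<psi> S k h g'" by auto
  then show ?case
    using Suc.IH[OF h(1)] kmeans_step_decreases[OF h(2) _ assms(3)] by fastforce
qed

subsection \<open>The loss of the matching algorithms\<close>

lemma block_eq_image: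
  assumes "s * k + k \<le> length xs"
  shows "block k xs s = (\<lambda>t. xs ! (s * k + t)) ` {..<k}"
proof -
  have "block k xs s = (!) (take k (drop (s * k) xs)) ` {..<k}"
    unfolding block_def using nth_image[of k "take k (drop (s * k) xs)"] assms
    by (simp add: lessThan_atLeast0)
  also have "\<dots> = (\<lambda>t. xs ! (s * k + t)) ` {..<k}" using assms by (intro image_cong) auto
  finally show ?thesis .
qed

lemma block_end_le: "s * k + k \<le> K * k" if "s < (K::nat)"
  using mult_le_mono1[of "Suc s" K k] that by simp

text \<open>Division with remainder: every index below \<open>K * k\<close> is
  \<open>s * k + t\<close> for exactly one \<open>s < K\<close> and \<open>t < k\<close>, and
  distinct indices carry distinct units.\<close>

lemma labelled_partition_block:
  assumes xs: "distinct xs" "set xs = S" and len: "length xs = K * k"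
  shows "labelled_partition S k K (block k xs)"
  unfolding labelled_partition_def
proof (intro conjI allI impI)
  have img: "block k xs s = (\<lambda>t. xs ! (s * k + t)) ` {..<k}" if "s < K" for s
    using block_end_le[OF that, of k] len by (intro block_eq_image) simp
  have idx: "s * k + t < length xs" if "s < K" "t < k" for s t
    using block_end_le[OF that(1), of k] that(2) len by simp
  have split: "s = s' \<and> t = t'" if "s * k + t = s' * k + t'" "t < k" "t' < k" for s t s' t' :: nat
  proof -
    have "(s * k + t) div k = s" "(s' * k + t') div k = s'" using that(2,3) by simp_all
    then show ?thesis using that(1) by simp
  qed
  show "card (block k xs s) = k" if "s < K" for s
    unfolding img[OF that] using xs idx[OF that]
    by (subst card_image) (auto simp: inj_on_def nth_eq_iff_index_eq)
  show "disjoint_family_on (block k xs) {..<K}"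
    unfolding disjoint_family_on_def
  proof (intro ballI impI)
    fix s s' assume ss': "s \<in> {..<K}" "s' \<in> {..<K}" "s \<noteq> s'"
    have "xs ! (s * k + t) \<noteq> xs ! (s' * k + t')" if "t < k" "t' < k" for t t'
    proof -
      have "s * k + t \<noteq> s' * k + t'" using split ss'(3) that by blast
      then show ?thesis using idx ss' that xs(1) by (simp add: nth_eq_iff_index_eq)
    qed
    then show "block k xs s \<inter> block k xs s' = {}" using ss' by (auto simp: img)
  qed
  show "(\<Union>s<K. block k xs s) = S"
  proof (intro equalityI subsetI)
    fix i assume "i \<in> (\<Union>s<K. block k xs s)"
    then show "i \<in> S" using xs(2) idx by (auto simp: img)
  next
    fix i assume "i \<in> S"
    then obtain p where p: "p < K * k" "i = xs ! p" using xs(2) len by (auto simp: in_set_conv_nth)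
    then have "k > 0" by (cases k) auto
    moreover have "p div k < K" using p by (simp add: less_mult_imp_div_less)
    ultimately show "i \<in> (\<Union>s<K. block k xs s)"
      using p by (auto simp: img intro!: bexI[of _ "p div k"] image_eqI[of _ _ "p mod k"])
  qed
qed

text \<open>The distance bound is linear in the rank difference, so each group is charged in
  proportion to the rank span up to the next group. These spans telescope to at most
  \<open>m ^ CARD('d)\<close>, and the factor \<open>1 / m\<close> lowers the exponent by
  one.\<close>

lemma sorted_partition_loss:
  fixes \<psi> :: "nat \<Rightarrow> real ^ 'd::finite"
  assumes e: "bij_betw e {1..CARD('d)} UNIV" and m: "m \<ge> 1" and k: "k \<ge> 1" "k dvd card S"
    and sorted: "spatially_sorted e \<psi> m S xs" and R: "\<And>i. i \<in> S \<Longrightarrow> norm (\<psi> i) \<le> R"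
  shows "(\<Sum>s<card S div k. group_loss \<psi> (block k xs s)) \<le>
    4 * R\<^sup>2 * (real (card S) * real CARD('d) / (real m)\<^sup>2 + 2 * real k * real m ^ (CARD('d) - 1))"
proof -
  define K where "K = card S div k"
  define rank where "rank i = cell_rank e m (rescale \<psi> S i)" for i
  \<comment> \<open>\<open>h s\<close> is the rank of the first unit of group \<open>s\<close>. Its
    value at \<open>K\<close> lies above all ranks, so the last group is treated like the
    others.\<close>
  define h where "h s = (if s < K then rank (xs ! (s * k)) else int m ^ CARD('d))" for s
  have xs: "distinct xs" "set xs = S" "sorted (map rank xs)"
    using sorted by (auto simp: spatially_sorted_def rank_def[abs_def])
  have S: "finite S" using xs(2) by auto
  have len: "length xs = K * k" using xs k distinct_card[of xs] by (simp add: K_def)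
  have part: "labelled_partition S k K (block k xs)"
    by (rule labelled_partition_block[OF xs(1,2) len])
  have idx: "s * k + t < length xs" if "s < K" "t < k" for s t
    using block_end_le[OF that(1), of k] that(2) len by simp
  have rank: "0 \<le> rank i" "rank i \<le> int m ^ CARD('d) - 1" if "i \<in> S" for i
    using cell_rank_bounds[of "rescale \<psi> S i" m e] rescale_bounds[OF S that] m by (auto simp: rank_def)
  have mono: "rank (xs ! p) \<le> rank (xs ! p')" if "p \<le> p'" "p' < length xs" for p p'
    using sorted_nth_mono[OF xs(3), of p p'] that by simp
  have step: "h s \<le> rank (xs ! (s * k + t)) \<and> rank (xs ! (s * k + t)) \<le> h (Suc s)"
    if st: "s < K" "t < k" for s t
  proof -
    have "rank (xs ! (s * k + t)) \<le> h (Suc s)"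
    proof (cases "Suc s < K")
      case True
      then show ?thesis using mono[of "s * k + t" "Suc s * k"] idx[of "Suc s" 0] st by (simp add: h_def)
    next
      case False
      then show ?thesis using rank(2)[of "xs ! (s * k + t)"] xs(2) nth_mem[OF idx[OF st]] by (simp add: h_def)
    qed
    then show ?thesis using mono[of "s * k" "s * k + t"] idx[OF st] st by (simp add: h_def)
  qed
  have group: "group_loss \<psi> (block k xs s) \<le>
      4 * R\<^sup>2 * (real k * real CARD('d) / (real m)\<^sup>2 + 2 * real k / real m * (of_int (h (Suc s)) - of_int (h s)))"
    if s: "s < K" for s
  proof -
    let ?B = "4 * R\<^sup>2 * (real CARD('d) / (real m)\<^sup>2 + 2 * of_int (h (Suc s) - h s) / real m)"
    have card: "card (block k xs s) = k" using part s by (simp add: labelled_partition_def)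
    \<comment> \<open>The first unit of the group replaces the centroid, because the rank bound
      compares two units.\<close>
    have "group_loss \<psi> (block k xs s) \<le> (\<Sum>i\<in>block k xs s. (norm (\<psi> i - \<psi> (xs ! (s * k))))\<^sup>2)"
      unfolding group_loss_def by (rule centroid_minimizes) (simp add: block_def)
    also have "\<dots> \<le> of_nat (card (block k xs s)) * ?B"
    proof (rule sum_bounded_above)
      fix i assume "i \<in> block k xs s"
      then obtain t where t: "t < k" "i = xs ! (s * k + t)"
        using block_eq_image[of s k xs] block_end_le[OF s, of k] len by auto
      have in_S: "i \<in> S" "xs ! (s * k) \<in> S"
        using idx[OF s t(1)] idx[OF s, of 0] k t(2) xs(2) by auto
      have "\<bar>rank i - rank (xs ! (s * k))\<bar> \<le> h (Suc s) - h s"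
        using step[OF s t(1)] t(2) s by (simp add: h_def)
      then have "4 * R\<^sup>2 * (real CARD('d) / (real m)\<^sup>2 + 2 * of_int \<bar>rank i - rank (xs ! (s * k))\<bar> / real m) \<le> ?B"
        by (intro mult_left_mono add_left_mono divide_right_mono) (auto simp flip: of_int_abs of_int_diff)
      with norm_dist_le_cell_rank[OF e m S in_S R]
      show "(norm (\<psi> i - \<psi> (xs ! (s * k))))\<^sup>2 \<le> ?B"
        unfolding rank_def by (rule order_trans)
    qed
    finally show ?thesis unfolding card by (simp add: algebra_simps)
  qed
  have "(\<Sum>s<K. group_loss \<psi> (block k xs s)) \<le>
      (\<Sum>s<K. 4 * R\<^sup>2 * (real k * real CARD('d) / (real m)\<^sup>2 + 2 * real k / real m * (of_int (h (Suc s)) - of_int (h s))))"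
    by (intro sum_mono group) auto
  also have "\<dots> = 4 * R\<^sup>2 * (real (K * k) * real CARD('d) / (real m)\<^sup>2 +
      2 * real k / real m * (of_int (h K) - of_int (h 0)))"
    by (simp only: sum.distrib sum_constant card_lessThan sum_lessThan_telescope[of "\<lambda>s. real_of_int (h s)"]
        flip: sum_distrib_left) simp
  also have "\<dots> \<le> 4 * R\<^sup>2 * (real (K * k) * real CARD('d) / (real m)\<^sup>2 +
      2 * real k / real m * real m ^ CARD('d))"
  proof -
    \<comment> \<open>This includes \<open>K = 0\<close>, where \<open>h 0\<close> is the sentinel
      value \<open>m ^ CARD('d)\<close>.\<close>
    have "0 \<le> h 0" using rank(1)[of "xs ! 0"] xs(2) idx[of 0 0] k by (auto simp: h_def)
    then have "real_of_int (h K) - of_int (h 0) \<le> real m ^ CARD('d)" using h_def[of K] by simp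
    then show ?thesis by (intro mult_left_mono add_left_mono) auto
  qed
  also have "2 * real k / real m * real m ^ CARD('d) = 2 * real k * real m ^ (CARD('d) - 1)"
    using m by (subst power_eq_if) auto
  also have "K * k = card S" using k by (simp add: K_def)
  finally show ?thesis by (simp only: K_def)
qed

text \<open>The polishing iterations are hidden here: later arguments see only the final groups and
  the fact that their loss is at most that of the sorted blocks.\<close>

lemma single_levelE:
  fixes \<psi> :: "nat \<Rightarrow> real ^ 'd::finite"
  assumes "single_level e \<psi> S k m T r P" "k \<ge> 1"
  obtains xs g where "spatially_sorted e \<psi> m (S - r) xs"
    "P = g ` {..<card (S - r) div k} \<union> (if r = {} then {} else {r})" "P \<subseteq> Pow S"
    "(\<Sum>s<card (S - r) div k. group_loss \<psi> (g s)) \<le> (\<Sum>s<card (S - r) div k. group_loss \<psi> (block k xs s))"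
proof -
  obtain xs g where xs: "spatially_sorted e \<psi> m (S - r) xs"
    and g: "(kmeans_step \<psi> (S - r) k ^^ T) (block k xs) g"
    and P: "P = g ` {..<card (S - r) div k} \<union> (if r = {} then {} else {r})"
    using assms by (auto simp: single_level_def)
  have r: "r \<subseteq> S" "k dvd card (S - r)" using assms by (auto simp: single_level_def)
  have part: "labelled_partition (S - r) k (card (S - r) div k) (block k xs)"
    using xs r distinct_card[of xs] by (intro labelled_partition_block) (auto simp: spatially_sorted_def)
  note * = kmeans_iterate_decreases[OF g part assms(2)]
  moreover from * have "P \<subseteq> Pow S" using r P by (auto simp: labelled_partition_def split: if_splits)
  ultimately show ?thesis using that xs P by blast
qed

text \<open>The fewer than \<open>k\<close> units of the remainder are compared with the point 0,
  which costs at most \<open>R\<^sup>2\<close> each. The bound \<open>B\<close> has to dominate the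
  sorting loss only when some unit is matched, as the grid size is controlled only in that
  case.\<close>

lemma single_level_loss:
  fixes \<psi> :: "nat \<Rightarrow> real ^ 'd::finite"
  assumes e: "bij_betw e {1..CARD('d)} UNIV" and m: "m \<ge> 1" and k: "k \<ge> 1"
    and alg: "single_level e \<psi> S k m T r P" and S: "finite S" and R: "\<And>i. i \<in> S \<Longrightarrow> norm (\<psi> i) \<le> R"
    and B: "0 \<le> B" "card (S - r) \<ge> 1 \<Longrightarrow>
      4 * R\<^sup>2 * (real (card (S - r)) * real CARD('d) / (real m)\<^sup>2 + 2 * real k * real m ^ (CARD('d) - 1)) \<le> B"
  shows "(\<Sum>g\<in>P. group_loss \<psi> g) \<le> B + real k * R\<^sup>2"
proof -
  obtain xs g where xs: "spatially_sorted e \<psi> m (S - r) xs"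
    and P: "P = g ` {..<card (S - r) div k} \<union> (if r = {} then {} else {r})"
    and le: "(\<Sum>s<card (S - r) div k. group_loss \<psi> (g s)) \<le>
      (\<Sum>s<card (S - r) div k. group_loss \<psi> (block k xs s))"
    using single_levelE[OF alg k] by metis
  have r: "r \<subseteq> S" "card r < k" "k dvd card (S - r)" using alg by (auto simp: single_level_def)
  \<comment> \<open>Passing from labels to the set of groups can only merge equal nonnegative
    terms.\<close>
  have "(\<Sum>g\<in>g ` {..<card (S - r) div k}. group_loss \<psi> g) \<le> (\<Sum>s<card (S - r) div k. group_loss \<psi> (g s))"
    using sum_image_le[of "{..<card (S - r) div k}" "group_loss \<psi>" g] by (simp add: group_loss_nonneg)
  also have "\<dots> \<le> B"
  proof (cases "card (S - r) \<ge> 1")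
    case True
    have "(\<Sum>s<card (S - r) div k. group_loss \<psi> (block k xs s)) \<le>
      4 * R\<^sup>2 * (real (card (S - r)) * real CARD('d) / (real m)\<^sup>2 + 2 * real k * real m ^ (CARD('d) - 1))"
      using R by (intro sorted_partition_loss[OF e m k r(3) xs]) auto
    then show ?thesis using le B(2)[OF True] by linarith
  next
    case False
    then have "card (S - r) = 0" by linarith
    then show ?thesis using B(1) by simp
  qed
  finally have 1: "(\<Sum>g\<in>g ` {..<card (S - r) div k}. group_loss \<psi> g) \<le> B" .
  have "group_loss \<psi> r \<le> (\<Sum>i\<in>r. (norm (\<psi> i - 0))\<^sup>2)"
    unfolding group_loss_def using r S by (intro centroid_minimizes finite_subset[of r S])
  also have "\<dots> \<le> of_nat (card r) * R\<^sup>2"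
    using r R by (intro sum_bounded_above) (auto intro!: power_mono)
  also have "\<dots> \<le> real k * R\<^sup>2" using r by (intro mult_right_mono) auto
  finally have 2: "group_loss \<psi> r \<le> real k * R\<^sup>2" .
  have "(\<Sum>g\<in>P. group_loss \<psi> g) \<le> (\<Sum>g\<in>g ` {..<card (S - r) div k}. group_loss \<psi> g) +
      (\<Sum>g\<in>(if r = {} then {} else {r}). group_loss \<psi> g)"
    unfolding P by (subst sum.union_inter[symmetric]) (auto intro!: sum_nonneg group_loss_nonneg)
  also have "(\<Sum>g\<in>(if r = {} then {} else {r}). group_loss \<psi> g) \<le> real k * R\<^sup>2"
    using 2 by auto
  finally show ?thesis using 1 by linarith
qed

text \<open>Let \<open>x = n / k\<close> and \<open>p = 1 / (d + 1)\<close>. The lower bound on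
  \<open>m\<close> makes the first term of order \<open>x powr (1 - 2 * p)\<close>, the upper bound
  makes the second of order \<open>x powr (p * (d - 1))\<close>. The two exponents agree, which is
  the balance behind this grid size; being nonnegative, they allow \<open>x\<close> to be enlarged
  to \<open>N\<close>.\<close>

lemma grid_rate:
  fixes c C :: real
  assumes pos: "0 < c" "0 < C" "k \<ge> 1" "n \<ge> 1" "n \<le> N" "d \<ge> 1"
    and lo: "c * (real n / real k) powr (1 / (real d + 1)) \<le> real m"
    and hi: "real m \<le> C * (real n / real k) powr (1 / (real d + 1))"
  shows "real n * real d / (real m)\<^sup>2 + 2 * real k * real m ^ (d - 1) \<le>
    (real d * real k / c\<^sup>2 + 2 * real k * C ^ (d - 1)) * real N powr (1 - 2 / (real d + 1))"
proof -
  define x where "x = real n / real k"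
  define p where "p = 1 / (real d + 1)"
  have x: "0 < x" "x \<le> real N"
  proof -
    show "0 < x" using pos by (simp add: x_def)
    have "x \<le> real n" using pos by (simp add: x_def divide_le_eq mult_le_cancel_left1)
    then show "x \<le> real N" using pos by simp
  qed
  have p: "1 - 2 * p \<ge> 0" "p * real (d - 1) = 1 - 2 * p"
    using pos(6) by (auto simp: p_def field_simps of_nat_diff)
  have power: "(x powr p) ^ j = x powr (p * real j)" for j
    using x by (simp add: powr_power mult.commute)
  have x_le: "x powr (1 - 2 * p) \<le> real N powr (1 - 2 * p)"
    using x p by (intro powr_mono2) auto
  have "(c * x powr p)\<^sup>2 \<le> (real m)\<^sup>2"
    using lo pos by (intro power_mono) (auto simp: x_def p_def)
  then have le: "c\<^sup>2 * x powr (2 * p) \<le> (real m)\<^sup>2"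
    using power[of 2] by (simp add: power_mult_distrib mult.commute)
  have pos': "0 < c\<^sup>2 * x powr (2 * p)" using pos x by simp
  have "0 < (real m)\<^sup>2 * (c\<^sup>2 * x powr (2 * p))" by (rule mult_pos_pos[OF order.strict_trans2[OF pos' le] pos'])
  with le have "real n * real d / (real m)\<^sup>2 \<le> real n * real d / (c\<^sup>2 * x powr (2 * p))"
    by (intro divide_left_mono) auto
  also have "\<dots> = real d * real k / c\<^sup>2 * (x / x powr (2 * p))"
    using pos by (simp add: x_def)
  also have "x / x powr (2 * p) = x powr (1 - 2 * p)" using x by (simp add: powr_diff)
  also have "real d * real k / c\<^sup>2 * \<dots> \<le> real d * real k / c\<^sup>2 * real N powr (1 - 2 * p)"
    by (intro mult_left_mono x_le) auto
  finally have 1: "real n * real d / (real m)\<^sup>2 \<le> real d * real k / c\<^sup>2 * real N powr (1 - 2 * p)" .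
  have "real m ^ (d - 1) \<le> (C * x powr p) ^ (d - 1)"
    using hi by (intro power_mono) (auto simp: x_def p_def)
  also have "\<dots> = C ^ (d - 1) * x powr (1 - 2 * p)" by (simp only: power_mult_distrib power p(2))
  also have "\<dots> \<le> C ^ (d - 1) * real N powr (1 - 2 * p)"
    using pos by (intro mult_left_mono x_le) auto
  finally have "2 * real k * real m ^ (d - 1) \<le> 2 * real k * (C ^ (d - 1) * real N powr (1 - 2 * p))"
    by (intro mult_left_mono) auto
  then show ?thesis using 1 by (simp add: p_def algebra_simps)
qed

section \<open>Summation over the levels\<close>

lemma sum_UN_le:
  fixes f :: "'b \<Rightarrow> real"
  assumes "finite I" "\<And>i. i \<in> I \<Longrightarrow> finite (A i)" "\<And>x. 0 \<le> f x"
  shows "(\<Sum>x\<in>(\<Union>i\<in>I. A i). f x) \<le> (\<Sum>i\<in>I. \<Sum>x\<in>A i. f x)"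
proof -
  have "(\<Union>i\<in>I. A i) = snd ` Sigma I A" by force
  then have "(\<Sum>x\<in>(\<Union>i\<in>I. A i). f x) \<le> (\<Sum>z\<in>Sigma I A. f (snd z))"
    using sum_image_le[of "Sigma I A" f snd] assms by (simp add: o_def)
  also have "\<dots> = (\<Sum>i\<in>I. \<Sum>x\<in>A i. f x)"
    using assms by (simp add: sum.Sigma case_prod_unfold)
  finally show ?thesis .
qed

text \<open>Only finitely many outputs are possible for given \<open>n\<close>; finiteness of the
  partitions and measurability of the loss rest on this.\<close>

lemma multi_level_subset:
  fixes \<psi> :: "nat \<Rightarrow> real ^ 'd::finite"
  assumes "multi_level e q L a k \<psi> n m T r G" "\<And>l. l \<in> {1..L} \<Longrightarrow> k l \<ge> 1"
  shows "G \<subseteq> Pow {1..n}"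
proof -
  obtain P where P: "\<And>l. l \<in> {1..L} \<Longrightarrow>
      single_level e \<psi> (level_units q a k \<psi> n l) (k l) (m l) (T l) (r l) (P l)"
    and G: "G = (\<Union>l\<in>{1..L}. P l)"
    using assms(1) unfolding multi_level_def by blast
  have "P l \<subseteq> Pow (level_units q a k \<psi> n l)" if "l \<in> {1..L}" for l
    using single_levelE[OF P[OF that] assms(2)[OF that]] by metis
  then show ?thesis unfolding G by (fastforce simp: level_units_def)
qed

text \<open>This is the deterministic core. Each level loses at most a constant times
  \<open>R\<^sup>2\<close> and the power of \<open>n\<close> from \<open>grid_rate\<close>; division
  by \<open>n\<close> lowers the exponent to \<open>- 2 / (CARD('d) + 1)\<close>.\<close>

lemma multi_level_loss:
  fixes \<psi> :: "nat \<Rightarrow> real ^ 'd::finite" and c C :: real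
  assumes e: "bij_betw e {1..CARD('d)} UNIV" and n: "n \<ge> 1"
    and k: "\<And>l. l \<in> {1..L} \<Longrightarrow> k l \<ge> 1" and m: "\<And>l. l \<in> {1..L} \<Longrightarrow> m l \<ge> 1"
    and c: "0 < c" "0 < C"
    and rate: "\<And>l n\<^sub>l. l \<in> {1..L} \<Longrightarrow> n\<^sub>l = card (level_units q a k \<psi> n l - r l) \<Longrightarrow> n\<^sub>l \<ge> 1 \<Longrightarrow>
        c * (real n\<^sub>l / real (k l)) powr (1 / (real CARD('d) + 1)) \<le> real (m l) \<and>
        real (m l) \<le> C * (real n\<^sub>l / real (k l)) powr (1 / (real CARD('d) + 1))"
    and alg: "multi_level e q L a k \<psi> n m T r G"
    and R: "\<And>i. i \<in> {1..n} \<Longrightarrow> norm (\<psi> i) \<le> R"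
  shows "within_group_loss \<psi> n G \<le> R\<^sup>2 * real n powr (- 2 / (real CARD('d) + 1)) *
    (\<Sum>l=1..L. 4 * (real CARD('d) * real (k l) / c\<^sup>2 + 2 * real (k l) * C ^ (CARD('d) - 1)) + real (k l))"
proof -
  obtain P where P: "\<And>l. l \<in> {1..L} \<Longrightarrow>
      single_level e \<psi> (level_units q a k \<psi> n l) (k l) (m l) (T l) (r l) (P l)"
    and G: "G = (\<Union>l\<in>{1..L}. P l)"
    using alg unfolding multi_level_def by blast
  let ?S = "level_units q a k \<psi> n"
  let ?N = "real n powr (1 - 2 / (real CARD('d) + 1))"
  let ?A = "\<lambda>l. real CARD('d) * real (k l) / c\<^sup>2 + 2 * real (k l) * C ^ (CARD('d) - 1)"
  have S: "?S l \<subseteq> {1..n}" for l by (auto simp: level_units_def)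
  have d: "CARD('d) \<ge> 1" by (simp add: Suc_leI)
  have A: "0 \<le> ?A l" for l using c by simp
  have level: "(\<Sum>g\<in>P l. group_loss \<psi> g) \<le> R\<^sup>2 * ?N * (4 * ?A l + real (k l))" if l: "l \<in> {1..L}" for l
  proof -
    have "(\<Sum>g\<in>P l. group_loss \<psi> g) \<le> 4 * R\<^sup>2 * (?A l * ?N) + real (k l) * R\<^sup>2"
    proof (rule single_level_loss[OF e m[OF l] k[OF l] P[OF l]])
      show "finite (?S l)" using S finite_subset by blast
      show "norm (\<psi> i) \<le> R" if "i \<in> ?S l" for i using S that R by blast
      show "0 \<le> 4 * R\<^sup>2 * (?A l * ?N)" using A by (intro mult_nonneg_nonneg) auto
      assume n\<^sub>l: "card (?S l - r l) \<ge> 1"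
      have "card (?S l - r l) \<le> card {1..n}" using S by (intro card_mono) auto
      then show "4 * R\<^sup>2 * (real (card (?S l - r l)) * real CARD('d) / (real (m l))\<^sup>2 +
          2 * real (k l) * real (m l) ^ (CARD('d) - 1)) \<le> 4 * R\<^sup>2 * (?A l * ?N)"
        using rate[OF l refl n\<^sub>l] by (intro mult_left_mono grid_rate c k l n\<^sub>l d) auto
    qed
    also have "\<dots> \<le> 4 * R\<^sup>2 * (?A l * ?N) + real (k l) * R\<^sup>2 * ?N"
    proof -
      \<comment> \<open>The exponent is nonnegative because the dimension is at least 1, so the cost
        of the remainder is absorbed into the rate.\<close>
      have "1 \<le> ?N" using n d by (intro ge_one_powr_ge_zero) (auto simp: field_simps)
      then have "real (k l) * R\<^sup>2 * 1 \<le> real (k l) * R\<^sup>2 * ?N" by (intro mult_left_mono) auto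
      then show ?thesis by simp
    qed
    finally show ?thesis by (simp add: algebra_simps)
  qed
  have "finite (P l)" if "l \<in> {1..L}" for l
    using that multi_level_subset[OF alg k] finite_subset[of "P l" "Pow {1..n}"] unfolding G by blast
  then have "(\<Sum>g\<in>G. group_loss \<psi> g) \<le> (\<Sum>l=1..L. \<Sum>g\<in>P l. group_loss \<psi> g)"
    unfolding G by (intro sum_UN_le group_loss_nonneg) auto
  also have "\<dots> \<le> R\<^sup>2 * ?N * (\<Sum>l=1..L. 4 * ?A l + real (k l))"
    unfolding sum_distrib_left by (intro sum_mono level) auto
  finally have "within_group_loss \<psi> n G \<le> (1 / real n) * (R\<^sup>2 * ?N * (\<Sum>l=1..L. 4 * ?A l + real (k l)))"
    unfolding within_group_loss_def group_loss_def by (intro mult_left_mono) auto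
  also have "\<dots> = R\<^sup>2 * (?N / real n) * (\<Sum>l=1..L. 4 * ?A l + real (k l))"
    by simp
  also have "?N / real n = real n powr (- 2 / (real CARD('d) + 1))"
    using n by (simp add: powr_diff powr_minus_divide)
  finally show ?thesis .
qed

subsection \<open>Tails of the largest covariate\<close>

text \<open>A sharpened Markov inequality: on the tail event \<open>A n\<close> the constant
  \<open>\<eta> * n\<close> is below \<open>\<bar>Y\<bar>\<close>, and the integral of
  \<open>\<bar>Y\<bar>\<close> over \<open>A n\<close> tends to 0 by dominated convergence.\<close>

lemma (in finite_measure) integrable_tail:
  fixes Y :: "'a \<Rightarrow> real"
  assumes Y: "integrable M Y" and \<eta>: "\<eta> > 0"
  shows "(\<lambda>n. real n * measure M {\<omega>\<in>space M. Y \<omega> > \<eta> * real n}) \<longlonglongrightarrow> 0"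
proof -
  define A where "A n = {\<omega>\<in>space M. Y \<omega> > \<eta> * real n}" for n
  define s where "s n \<omega> = indicator (A n) \<omega> * \<bar>Y \<omega>\<bar>" for n \<omega>
  have [measurable]: "Y \<in> borel_measurable M" using Y by auto
  have [measurable]: "A n \<in> sets M" for n unfolding A_def by measurable
  have lim: "(\<lambda>n. s n \<omega>) \<longlonglongrightarrow> 0" for \<omega>
  proof (rule tendsto_eventually)
    obtain N where "Y \<omega> / \<eta> < real N" using reals_Archimedean2 by blast
    then have "Y \<omega> \<le> \<eta> * real n" if "n \<ge> N" for n
    proof -
      have "Y \<omega> / \<eta> \<le> real n" using \<open>Y \<omega> / \<eta> < real N\<close> that by linarith
      then show ?thesis using \<eta> by (simp add: field_simps)
    qed
    then show "\<forall>\<^sub>F n in sequentially. s n \<omega> = 0"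
      unfolding eventually_sequentially s_def A_def by (intro exI[of _ N]) (auto simp: indicator_def not_less)
  qed
  have int: "integrable M (s n)" for n
    using integrable_mult_indicator[of "A n" M "\<lambda>\<omega>. \<bar>Y \<omega>\<bar>"] Y by (simp add: s_def[abs_def])
  have "(\<lambda>n. integral\<^sup>L M (s n)) \<longlonglongrightarrow> integral\<^sup>L M (\<lambda>_. 0 :: real)"
  proof (rule integral_dominated_convergence)
    show "integrable M (\<lambda>\<omega>. \<bar>Y \<omega>\<bar>)" using Y by auto
    show "s n \<in> borel_measurable M" for n unfolding s_def by measurable
    show "AE \<omega> in M. (\<lambda>n. s n \<omega>) \<longlonglongrightarrow> 0" using lim by simp
    show "AE \<omega> in M. norm (s n \<omega>) \<le> \<bar>Y \<omega>\<bar>" for n by (simp add: s_def indicator_def)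
  qed simp
  then have "(\<lambda>n. integral\<^sup>L M (s n) / \<eta>) \<longlonglongrightarrow> 0"
    by (intro tendsto_divide_zero) simp
  then have "(\<lambda>n. real n * measure M (A n)) \<longlonglongrightarrow> 0"
  proof (rule tendsto_sandwich[where f = "\<lambda>_. 0", rotated 3])
    have "\<eta> * real n * measure M (A n) \<le> integral\<^sup>L M (s n)" for n
    proof -
      have "\<eta> * real n * measure M (A n) = (\<integral>\<omega>. \<eta> * real n * indicator (A n) \<omega> \<partial>M)"
        by (simp add: Int_absorb2 sets.sets_into_space)
      also have "\<dots> \<le> integral\<^sup>L M (s n)"
        by (intro integral_mono int integrable_mult_right integrable_real_indicator)
          (auto simp: s_def A_def indicator_def emeasure_eq_measure)
      finally show ?thesis .
    qed
    then have "real n * measure M (A n) \<le> integral\<^sup>L M (s n) / \<eta>" for n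
      using \<eta> by (simp add: field_simps)
    then show "\<forall>\<^sub>F n in sequentially. real n * measure M (A n) \<le> integral\<^sup>L M (s n) / \<eta>" by simp
  qed auto
  then show ?thesis unfolding A_def .
qed

text \<open>The union bound and the common distribution give \<open>n\<close> times a single tail
  probability. Raising the inequality to the power \<open>\<alpha>\<close> brings it into the form
  of \<open>integrable_tail\<close> with \<open>\<eta> = \<delta> powr \<alpha>\<close>.\<close>

lemma (in prob_space) max_norm_tail:
  fixes \<psi> :: "nat \<Rightarrow> 'a \<Rightarrow> real ^ 'd::finite" and \<alpha> \<delta> :: real
  assumes meas: "\<And>i. i \<ge> 1 \<Longrightarrow> \<psi> i \<in> borel_measurable M"
    and ident: "\<And>i. i \<ge> 1 \<Longrightarrow> distr M borel (\<psi> i) = distr M borel (\<psi> 1)"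
    and moment: "integrable M (\<lambda>\<omega>. norm (\<psi> 1 \<omega>) powr \<alpha>)" and pos: "\<alpha> > 0" "\<delta> > 0"
  shows "(\<lambda>n. prob (\<Union>i\<in>{1..n}. {\<omega>\<in>space M. norm (\<psi> i \<omega>) > \<delta> * real n powr (1 / \<alpha>)})) \<longlonglongrightarrow> 0"
proof (rule tendsto_sandwich[where f = "\<lambda>_. 0"])
  let ?A = "\<lambda>n i. {\<omega>\<in>space M. norm (\<psi> i \<omega>) > \<delta> * real n powr (1 / \<alpha>)}"
  have [measurable]: "\<psi> 1 \<in> borel_measurable M" using meas by simp
  show "(\<lambda>n. real n * prob {\<omega>\<in>space M. norm (\<psi> 1 \<omega>) powr \<alpha> > \<delta> powr \<alpha> * real n}) \<longlonglongrightarrow> 0"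
    using pos by (intro integrable_tail[OF moment]) simp
  have A1: "prob (?A n i) = prob (?A n 1)" if i: "i \<ge> 1" for n i
  proof -
    have "prob (?A n j) = measure (distr M borel (\<psi> j)) {x. norm x > \<delta> * real n powr (1 / \<alpha>)}" if "j \<ge> 1" for j
    proof -
      have "{\<omega>\<in>space M. norm (\<psi> j \<omega>) > \<delta> * real n powr (1 / \<alpha>)} =
          \<psi> j -` {x. norm x > \<delta> * real n powr (1 / \<alpha>)} \<inter> space M" by blast
      also have "prob \<dots> = measure (distr M borel (\<psi> j)) {x. norm x > \<delta> * real n powr (1 / \<alpha>)}"
        using meas[OF that] by (rule measure_distr[symmetric]) measurable
      finally show ?thesis .
    qed
    from this[OF i] this[of 1] show ?thesis unfolding ident[OF i] by (simp only: order_refl)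
  qed
  have "prob (\<Union>i\<in>{1..n}. ?A n i) \<le> real n * prob {\<omega>\<in>space M. norm (\<psi> 1 \<omega>) powr \<alpha> > \<delta> powr \<alpha> * real n}" for n
  proof -
    have "prob (\<Union>i\<in>{1..n}. ?A n i) \<le> (\<Sum>i=1..n. prob (?A n i))"
    proof (rule measure_UNION_le)
      fix i assume "i \<in> {1..n}"
      then have [measurable]: "\<psi> i \<in> borel_measurable M" using meas by simp
      show "?A n i \<in> sets M" by measurable
    qed simp
    also have "\<dots> = (\<Sum>i=1..n. prob (?A n 1))" by (intro sum.cong refl A1) simp
    also have "\<dots> = real n * prob (?A n 1)" by simp
    also have "\<dots> \<le> real n * prob {\<omega>\<in>space M. norm (\<psi> 1 \<omega>) powr \<alpha> > \<delta> powr \<alpha> * real n}"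
    proof (rule mult_left_mono[OF finite_measure_mono[OF subsetI] of_nat_0_le_iff])
      have [measurable]: "(\<lambda>\<omega>. norm (\<psi> 1 \<omega>) powr \<alpha>) \<in> borel_measurable M"
        using moment by (rule borel_measurable_integrable)
      show "{\<omega>\<in>space M. norm (\<psi> 1 \<omega>) powr \<alpha> > \<delta> powr \<alpha> * real n} \<in> sets M" by measurable
    next
      fix \<omega> assume \<omega>: "\<omega> \<in> ?A n 1"
      have "\<delta> powr \<alpha> * real n = (\<delta> * real n powr (1 / \<alpha>)) powr \<alpha>"
        using pos by (simp add: powr_mult powr_powr)
      also have "\<dots> < norm (\<psi> 1 \<omega>) powr \<alpha>"
        using \<omega> pos by (intro powr_less_mono2) auto
      finally show "\<omega> \<in> {\<omega>\<in>space M. norm (\<psi> 1 \<omega>) powr \<alpha> > \<delta> powr \<alpha> * real n}"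
        using \<omega> by blast
    qed
    finally show ?thesis .
  qed
  then show "\<forall>\<^sub>F n in sequentially. prob (\<Union>i\<in>{1..n}. ?A n i) \<le>
      real n * prob {\<omega>\<in>space M. norm (\<psi> 1 \<omega>) powr \<alpha> > \<delta> powr \<alpha> * real n}" by simp
qed auto

section \<open>Measurability of the loss\<close>

lemma within_group_loss_measurable:
  fixes \<psi> :: "nat \<Rightarrow> 'w \<Rightarrow> real ^ 'd::finite"
  assumes meas: "\<And>i. i \<ge> 1 \<Longrightarrow> \<psi> i \<in> borel_measurable M"
    and G: "G \<in> measurable M (count_space UNIV)" "\<And>\<omega>. \<omega> \<in> space M \<Longrightarrow> G \<omega> \<subseteq> Pow {1..n}"
  shows "(\<lambda>\<omega>. within_group_loss (\<lambda>i. \<psi> i \<omega>) n (G \<omega>)) \<in> borel_measurable M"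
  \<comment> \<open>\<open>count_space UNIV\<close> is over an uncountable type, but \<open>G\<close> takes finitely many values.\<close>
proof (rule measurable_compose_countable'[where g = G and I = "Pow (Pow {1..n})"])
  fix H assume H: "H \<in> Pow (Pow {1..n})"
  have psi: "\<psi> i \<in> borel_measurable M" if "i \<in> g" "g \<in> H" for i g
    using that H by (intro meas) fastforce
  have "(\<lambda>\<omega>. (norm (\<psi> i \<omega> - centroid (\<lambda>i. \<psi> i \<omega>) g))\<^sup>2) \<in> borel_measurable M" if "i \<in> g" "g \<in> H" for i g
  proof -
    have [measurable]: "\<psi> i \<in> borel_measurable M" "(\<lambda>\<omega>. \<Sum>i\<in>g. \<psi> i \<omega>) \<in> borel_measurable M"
      using that by (auto intro!: borel_measurable_sum psi)
    show ?thesis unfolding centroid_def by measurable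
  qed
  then show "(\<lambda>\<omega>. within_group_loss (\<lambda>i. \<psi> i \<omega>) n H) \<in> borel_measurable M"
    unfolding within_group_loss_def
    by (intro borel_measurable_times borel_measurable_const borel_measurable_sum)
next
  show "G \<in> measurable M (count_space (Pow (Pow {1..n})))"
    using G by (intro measurableI) (auto dest: measurable_sets)
qed (auto intro: countable_finite)

section \<open>From the deterministic bound to convergence in probability\<close>

theorem theorem3p1:
  fixes M :: "'w measure"
    and \<psi> :: "nat \<Rightarrow> 'w \<Rightarrow> real ^ 'd"
    and \<alpha> :: real
    and e :: "nat \<Rightarrow> 'd"
    and q :: "real ^ 'd \<Rightarrow> real"
    and L :: nat
    and a k :: "nat \<Rightarrow> nat"
    and m T :: "nat \<Rightarrow> 'w \<Rightarrow> nat \<Rightarrow> nat"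
    and r :: "nat \<Rightarrow> 'w \<Rightarrow> nat \<Rightarrow> nat set"
    and G :: "nat \<Rightarrow> 'w \<Rightarrow> nat set set"
    and c C :: real
  assumes "prob_space M"
    and indep: "prob_space.indep_vars M (\<lambda>_. borel) \<psi> {1..}"
    and ident: "\<And>i. i \<ge> 1 \<Longrightarrow> distr M borel (\<psi> i) = distr M borel (\<psi> 1)"
    and alpha: "\<alpha> > real CARD('d) + 1"
    and moment: "integrable M (\<lambda>\<omega>. norm (\<psi> 1 \<omega>) powr \<alpha>)"
    and enum: "bij_betw e {1..CARD('d)} UNIV"
    and q_meas: "q \<in> borel_measurable borel"
    and q_range: "\<And>x. 0 < q x \<and> q x \<le> 1"
    and k_pos: "\<And>l. l \<in> {1..L} \<Longrightarrow> k l \<ge> 1"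
    and q_values: "\<And>x. \<exists>l\<in>{1..L}. q x = real (a l) / real (k l)"
    and levels_distinct: "inj_on (\<lambda>l. real (a l) / real (k l)) {1..L}"
    and m_pos: "\<And>n \<omega> l. \<omega> \<in> space M \<Longrightarrow> l \<in> {1..L} \<Longrightarrow> m n \<omega> l \<ge> 1"
    and "0 < c" and "0 < C"
    and m_rate: "\<And>n \<omega> l n\<^sub>l. \<omega> \<in> space M \<Longrightarrow> l \<in> {1..L} \<Longrightarrow>
        n\<^sub>l = card (level_units q a k (\<lambda>i. \<psi> i \<omega>) n l - r n \<omega> l) \<Longrightarrow> n\<^sub>l \<ge> 1 \<Longrightarrow>
        c * (real n\<^sub>l / real (k l)) powr (1 / (real CARD('d) + 1)) \<le> real (m n \<omega> l) \<and>
        real (m n \<omega> l) \<le> C * (real n\<^sub>l / real (k l)) powr (1 / (real CARD('d) + 1))"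
    and G_alg: "\<And>n \<omega>. \<omega> \<in> space M \<Longrightarrow>
        multi_level e q L a k (\<lambda>i. \<psi> i \<omega>) n (m n \<omega>) (T n \<omega>) (r n \<omega>) (G n \<omega>)"
    and G_meas: "\<And>n. G n \<in> measurable M (count_space UNIV)"
  shows "small_o_prob M (\<lambda>n \<omega>. within_group_loss (\<lambda>i. \<psi> i \<omega>) n (G n \<omega>))
           (\<lambda>n. real n powr (2 / \<alpha> - 2 / (real CARD('d) + 1))) \<and>
         small_o_prob M (\<lambda>n \<omega>. within_group_loss (\<lambda>i. \<psi> i \<omega>) n (G n \<omega>)) (\<lambda>_. 1)"
proof -
  interpret prob_space M by fact
  let ?X = "\<lambda>n \<omega>. within_group_loss (\<lambda>i. \<psi> i \<omega>) n (G n \<omega>)"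
  let ?b = "\<lambda>n. real n powr (2 / \<alpha> - 2 / (real CARD('d) + 1))"
  \<comment> \<open>The constant of \<open>multi_level_loss\<close>, which depends neither on
    \<open>n\<close> nor on the sample point.\<close>
  define K where "K = (\<Sum>l=1..L. 4 * (real CARD('d) * real (k l) / c\<^sup>2 +
    2 * real (k l) * C ^ (CARD('d) - 1)) + real (k l))"
  have K: "0 \<le> K" unfolding K_def using \<open>0 < C\<close> by (intro sum_nonneg) auto
  have meas: "\<psi> i \<in> borel_measurable M" if "i \<ge> 1" for i
    using indep that unfolding indep_vars_def2 by blast
  have X_meas [measurable]: "?X n \<in> borel_measurable M" for n
    by (rule within_group_loss_measurable[OF meas G_meas multi_level_subset[OF G_alg k_pos]])
  have X_nonneg: "0 \<le> ?X n \<omega>" for n \<omega>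
    by (auto simp: within_group_loss_def intro!: sum_nonneg divide_nonneg_nonneg)
  have main: "(\<lambda>n. prob {\<omega> \<in> space M. \<bar>?X n \<omega> / ?b n\<bar> > \<epsilon>}) \<longlonglongrightarrow> 0" if \<epsilon>: "\<epsilon> > 0" for \<epsilon>
  proof (rule tendsto_sandwich[where f = "\<lambda>_. 0"])
    \<comment> \<open>Chosen so that the loss bound with
      \<open>R = \<delta> * n powr (1 / \<alpha>)\<close> is at most \<open>\<epsilon>\<close> times
      the rate; the added 1 keeps the denominator positive given only
      \<open>0 \<le> K\<close>.\<close>
    define \<delta> where "\<delta> = sqrt (\<epsilon> / (K + 1))"
    have \<delta>: "\<delta> > 0" "\<delta>\<^sup>2 * K \<le> \<epsilon>" using K \<epsilon> by (auto simp: \<delta>_def field_simps)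
    let ?A = "\<lambda>n. \<Union>i\<in>{1..n}. {\<omega>\<in>space M. norm (\<psi> i \<omega>) > \<delta> * real n powr (1 / \<alpha>)}"
    show "(\<lambda>n. prob (?A n)) \<longlonglongrightarrow> 0"
      using alpha \<delta> by (intro max_norm_tail meas ident moment) auto
    have "prob {\<omega> \<in> space M. \<bar>?X n \<omega> / ?b n\<bar> > \<epsilon>} \<le> prob (?A n)" if n: "n \<ge> 1" for n
    proof (rule finite_measure_mono)
      show "?A n \<in> sets M"
      proof (rule sets.finite_UN)
        fix i assume "i \<in> {1..n}"
        then have [measurable]: "\<psi> i \<in> borel_measurable M" using meas by simp
        show "{\<omega>\<in>space M. norm (\<psi> i \<omega>) > \<delta> * real n powr (1 / \<alpha>)} \<in> sets M" by measurable
      qed simp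
      show "{\<omega> \<in> space M. \<bar>?X n \<omega> / ?b n\<bar> > \<epsilon>} \<subseteq> ?A n"
      proof (intro subsetI, rule ccontr)
        fix \<omega>
        assume "\<omega> \<in> {\<omega> \<in> space M. \<bar>?X n \<omega> / ?b n\<bar> > \<epsilon>}"
        then have \<omega>: "\<omega> \<in> space M" "\<bar>?X n \<omega> / ?b n\<bar> > \<epsilon>" by blast+
        assume "\<omega> \<notin> ?A n"
        \<comment> \<open>Off the exceptional event all covariates are small at once, so
          \<open>multi_level_loss\<close> applies pointwise, and squaring \<open>R\<close> produces
          the factor \<open>n powr (2 / \<alpha>)\<close>.\<close>
        then have R: "norm (\<psi> i \<omega>) \<le> \<delta> * real n powr (1 / \<alpha>)" if "i \<in> {1..n}" for i
          using \<omega>(1) that by (auto simp: not_less)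
        have "?X n \<omega> \<le> (\<delta> * real n powr (1 / \<alpha>))\<^sup>2 * real n powr (- 2 / (real CARD('d) + 1)) * K"
          unfolding K_def
          by (rule multi_level_loss[OF enum n k_pos m_pos[OF \<omega>(1)] \<open>0 < c\<close> \<open>0 < C\<close> m_rate[OF \<omega>(1)]
                G_alg[OF \<omega>(1)] R])
        also have "\<dots> = \<delta>\<^sup>2 * K * ?b n"
        proof -
          have "(real n powr (1 / \<alpha>))\<^sup>2 = real n powr (2 / \<alpha>)" using n by (simp add: powr_power)
          moreover have "real n powr (2 / \<alpha>) * real n powr (- 2 / (real CARD('d) + 1)) = ?b n"
            by (simp flip: powr_add)
          ultimately show ?thesis by (simp add: power_mult_distrib mult.assoc mult.commute mult.left_commute)
        qed
        also have "\<dots> \<le> \<epsilon> * ?b n" using \<delta> by (intro mult_right_mono) auto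
        finally have "?X n \<omega> / ?b n \<le> \<epsilon>" using n by (simp add: divide_le_eq)
        then show False using \<omega>(2) X_nonneg[of \<omega> n] by simp
      qed
    qed
    then show "\<forall>\<^sub>F n in sequentially. prob {\<omega> \<in> space M. \<bar>?X n \<omega> / ?b n\<bar> > \<epsilon>} \<le> prob (?A n)"
      by (auto simp: eventually_sequentially)
  qed auto
  moreover have "(\<lambda>n. prob {\<omega> \<in> space M. \<bar>?X n \<omega> / 1\<bar> > \<epsilon>}) \<longlonglongrightarrow> 0" if \<epsilon>: "\<epsilon> > 0" for \<epsilon>
  \<comment> \<open>Since \<open>\<alpha>\<close> exceeds \<open>CARD('d) + 1\<close>, the exponent
    of the rate is negative. Hence \<open>?b n\<close> is at most 1, and dividing the nonnegative
    loss by it can only enlarge the event.\<close>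
  proof (rule tendsto_sandwich[where f = "\<lambda>_. 0", OF _ _ _ main[OF \<epsilon>]])
    have "prob {\<omega> \<in> space M. \<bar>?X n \<omega> / 1\<bar> > \<epsilon>} \<le> prob {\<omega> \<in> space M. \<bar>?X n \<omega> / ?b n\<bar> > \<epsilon>}"
      if n: "n \<ge> 1" for n
    proof (rule finite_measure_mono)
      have "2 / \<alpha> \<le> 2 / (real CARD('d) + 1)" using alpha by (intro divide_left_mono) auto
      then have "?b n \<le> real n powr 0" using n by (intro powr_mono) auto
      then have b: "0 < ?b n" "?b n \<le> 1" using n by auto
      have "?X n \<omega> \<le> ?X n \<omega> / ?b n" for \<omega>
        using b X_nonneg[of \<omega> n] by (simp add: le_divide_eq mult_left_le)
      then show "{\<omega> \<in> space M. \<bar>?X n \<omega> / 1\<bar> > \<epsilon>} \<subseteq> {\<omega> \<in> space M. \<bar>?X n \<omega> / ?b n\<bar> > \<epsilon>}"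
        using X_nonneg b by (auto simp: less_le_trans)
    qed measurable
    then show "\<forall>\<^sub>F n in sequentially. prob {\<omega> \<in> space M. \<bar>?X n \<omega> / 1\<bar> > \<epsilon>} \<le>
        prob {\<omega> \<in> space M. \<bar>?X n \<omega> / ?b n\<bar> > \<epsilon>}"
      by (auto simp: eventually_sequentially)
  qed auto
  ultimately show ?thesis unfolding small_o_prob_def using X_meas by blast
qed

end
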